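(* Let $\mathcal{AP}\subset\mathbb{C}^{\mathbb{Z}}$ be the uniform closure (closure in the $\ell^\infty$ norm) of the set of finite complex linear combinations of functions on $\mathbb{Z}$ of the form $n\mapsto e^{2\pi i n\theta}$, $\theta\in\mathbb{T}=\mathbb{R}/\mathbb{Z}$. Then $\mathcal{AP}$ admits recovery.
   Context: Noise: $\xi=(\xi_n)_{n\in\mathbb{Z}}$ is a sequence of independent standard complex Gaussian random variables, meaning that the real and imaginary parts of each $\xi_n$ are independent and each distributed as $N(0,1)$. A set $\mathcal{X}\subset\mathbb{C}^{\mathbb{Z}}$ admits recovery if there is a map $T:\mathbb{C}^{\mathbb{Z}}\to\mathbb{C}^{\mathbb{Z}}$, Borel measurable for the product topology, such that for each $x\in\mathcal{X}$, $T(x+\xi)=x$ almost surely. *)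

theory Defs
  imports "HOL-Probability.Probability"
begin

definition standard_complex_gaussian :: "'w measure \<Rightarrow> ('w \<Rightarrow> complex) \<Rightarrow> bool" where
  "standard_complex_gaussian M Z \<longleftrightarrow>
     distributed M lborel (\<lambda>\<omega>. Re (Z \<omega>)) std_normal_density \<and>
     distributed M lborel (\<lambda>\<omega>. Im (Z \<omega>)) std_normal_density \<and>
     prob_space.indep_var M borel (\<lambda>\<omega>. Re (Z \<omega>)) borel (\<lambda>\<omega>. Im (Z \<omega>))"

definition gaussian_noise :: "'w measure \<Rightarrow> (int \<Rightarrow> 'w \<Rightarrow> complex) \<Rightarrow> bool" where
  "gaussian_noise M \<xi> \<longleftrightarrow>
     prob_space M \<and>
     prob_space.indep_vars M (\<lambda>_. borel) \<xi> UNIV \<and>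
     (\<forall>n. standard_complex_gaussian M (\<xi> n))"

(* borel on int => complex is the Borel sigma-algebra of the product topology
   (the topology that HOL-Analysis.Function_Topology puts on function types). *)
definition admits_recovery ::
    "'w measure \<Rightarrow> (int \<Rightarrow> 'w \<Rightarrow> complex) \<Rightarrow> (int \<Rightarrow> complex) set \<Rightarrow> bool" where
  "admits_recovery M \<xi> X \<longleftrightarrow>
     (\<exists>T :: (int \<Rightarrow> complex) \<Rightarrow> (int \<Rightarrow> complex).
        T \<in> borel_measurable borel \<and>
        (\<forall>x\<in>X. AE \<omega> in M. T (\<lambda>n. x n + \<xi> n \<omega>) = x))"

(* Frequencies in R/Z are given by real representatives. *)
definition trig_polys :: "(int \<Rightarrow> complex) set" where
  "trig_polys =
     {\<lambda>n. \<Sum>\<theta>\<in>F. c \<theta> * exp (2 * complex_of_real pi * \<i> * of_int n * complex_of_real \<theta>)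
       | (F :: real set) c. finite F}"

(* The integers carry the discrete topology, so int =>\<^sub>C complex is l^infinity(Z) with the
   sup metric; trig_polys_bounded shows that no trigonometric polynomial is lost, and
   AP_iff that AP is the uniform closure. *)
definition AP :: "(int \<Rightarrow> complex) set" where
  "AP = apply_bcontfun ` closure {p :: int \<Rightarrow>\<^sub>C complex. apply_bcontfun p \<in> trig_polys}"

lemma trig_polys_bounded: "trig_polys \<subseteq> bcontfun"
proof
  fix p assume "p \<in> trig_polys"
  then obtain F :: "real set" and c where p:
    "p = (\<lambda>n. \<Sum>\<theta>\<in>F. c \<theta> * exp (2 * complex_of_real pi * \<i> * of_int n * complex_of_real \<theta>))"
    unfolding trig_polys_def by blast
  have e: "norm (exp (2 * complex_of_real pi * \<i> * of_int n * complex_of_real \<theta>)) = 1"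
    for n :: int and \<theta> :: real
    by (simp add: norm_exp_eq_Re)
  have "norm (p n) \<le> (\<Sum>\<theta>\<in>F. norm (c \<theta>))" for n
    unfolding p by (rule sum_norm_le) (simp add: norm_mult e)
  then have "bounded (range p)"
    unfolding bounded_iff by blast
  then show "p \<in> bcontfun"
    by (simp add: bcontfun_def)
qed

lemma AP_iff: "x \<in> AP \<longleftrightarrow> (\<forall>e>0. \<exists>p\<in>trig_polys. \<forall>n. norm (x n - p n) \<le> e)"
proof
  assume "x \<in> AP"
  then obtain g where g: "x = apply_bcontfun g"
    "g \<in> closure {p. apply_bcontfun p \<in> trig_polys}"
    unfolding AP_def by blast
  show "\<forall>e>0. \<exists>p\<in>trig_polys. \<forall>n. norm (x n - p n) \<le> e"
  proof (intro allI impI)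
    fix e :: real assume "e > 0"
    then obtain q where q: "apply_bcontfun q \<in> trig_polys" "dist q g < e"
      using g(2) unfolding closure_approachable by blast
    have "norm (x n - q n) \<le> e" for n
      using dist_bounded[of g n q] q(2) by (simp add: g(1) dist_norm norm_minus_commute)
    with q(1) show "\<exists>p\<in>trig_polys. \<forall>n. norm (x n - p n) \<le> e" by blast
  qed
next
  assume *: "\<forall>e>0. \<exists>p\<in>trig_polys. \<forall>n. norm (x n - p n) \<le> e"
  obtain p where p: "p \<in> trig_polys" "\<And>n. norm (x n - p n) \<le> 1"
    using * zero_less_one by blast
  have "bounded (range p)"
    using p(1) trig_polys_bounded by (auto simp: bcontfun_def)
  then obtain B where B: "\<And>n. norm (p n) \<le> B"
    unfolding bounded_iff by blast
  have "norm (x n) \<le> 1 + B" for n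
    using norm_triangle_sub[of "x n" "p n"] p(2)[of n] B[of n] by linarith
  then have "bounded (range x)"
    unfolding bounded_iff by blast
  then have "x \<in> bcontfun" by (simp add: bcontfun_def)
  then obtain g where g: "x = apply_bcontfun g" by (rule bcontfunE)
  have "g \<in> closure {p. apply_bcontfun p \<in> trig_polys}"
    unfolding closure_approachable
  proof (intro allI impI)
    fix e :: real assume "e > 0"
    then obtain q where q: "q \<in> trig_polys" "\<And>n. norm (x n - q n) \<le> e / 2"
      using * half_gt_zero by blast
    obtain h where h: "q = apply_bcontfun h"
      using q(1) trig_polys_bounded bcontfunE by blast
    have "dist h g \<le> e / 2"
      by (rule dist_bound) (use q(2) in \<open>simp add: g h dist_norm norm_minus_commute\<close>)
    with \<open>e > 0\<close> q(1) h show "\<exists>y\<in>{p. apply_bcontfun p \<in> trig_polys}. dist y g < e"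
      by (intro bexI[of _ h]) auto
  qed
  then show "x \<in> AP" unfolding AP_def g by blast
qed

end

theory Submission
  imports Defs
begin

text \<open>Let \<open>y = x + \<xi>\<close>. For \<open>t > 0\<close> the mean of \<open>|y(m + t) - y(m)|^2\<close> over \<open>0 \<le> m < 2^k\<close>
  differs from the corresponding mean for \<open>x\<close> by \<open>4 + o(1)\<close> almost surely, so that the set
  \<open>P(j)\<close> of all \<open>t > 0\<close> for which the mean square of \<open>x(m + t) - x(m)\<close> is below
  \<open>1/(j + 1)\<close> can be read off from \<open>y\<close>. As \<open>x\<close> is almost periodic, \<open>P(j)\<close> is infinite, and
  \<open>x(n + t) - x(n)\<close> is uniformly small for \<open>t\<close> in \<open>P(j)\<close> as \<open>j\<close> grows. Almost surely \<open>P(j)\<close> does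
  not depend on the noise, so averaging \<open>y(n + t)\<close> over the first \<open>2^j\<close> elements \<open>t\<close> of
  \<open>P(j)\<close> removes the noise, and these averages converge to \<open>x(n)\<close>.\<close>

section \<open>Almost periods and mean squares\<close>

text \<open>Pigeonhole on the torus: the real and imaginary parts of all characters in
  \<open>F\<close> are rounded to a grid of mesh \<open>1 / N\<close>. Only finitely many cells
  occur, and one integer is kept for each.\<close>

lemma characters_finite_net:
  fixes F :: "real set" and e :: real
  defines "w \<equiv> \<lambda>(n::int) \<theta>. exp (2 * complex_of_real pi * \<i> * of_int n * complex_of_real \<theta>)"
  assumes F: "finite F" and e: "e > 0"
  obtains S where "finite S" "\<And>n. \<exists>s\<in>S. \<forall>\<theta>\<in>F. cmod (w n \<theta> - w s \<theta>) \<le> e"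
proof -
  \<comment> \<open>Two points of one cell differ by at most \<open>1 / N\<close> in each of the two
    parts, hence by at most \<open>2 / N\<close> in modulus.\<close>
  obtain N :: nat where N: "2 / e < real N"
    using reals_Archimedean2 by blast
  have "real N > 0"
    by (rule order.strict_trans[OF _ N]) (use e in simp)
  define r where "r t = \<lfloor>real N * t\<rfloor>" for t
  have r_eq: "\<bar>a - b\<bar> \<le> 1 / N" if "r a = r b" for a b
  proof -
    have "\<bar>real N * a - real N * b\<bar> \<le> 1"
      using that floor_correct[of "real N * a"] floor_correct[of "real N * b"]
      unfolding r_def by linarith
    then have "real N * \<bar>a - b\<bar> \<le> 1"
      by (metis abs_mult abs_of_nat right_diff_distrib)
    with \<open>real N > 0\<close> show ?thesis by (simp add: field_simps)
  qed
  have r_range: "r a \<in> {- int N..int N}" if "\<bar>a\<bar> \<le> 1" for a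
  proof -
    have "\<bar>real N * a\<bar> \<le> real N"
      using that by (simp add: abs_mult mult_left_le)
    then have "- real N \<le> real N * a" "real N * a \<le> real N"
      by linarith+
    then show ?thesis
      unfolding r_def by (simp add: le_floor_iff floor_le_iff)
  qed
  have norm_w: "cmod (w n \<theta>) = 1" for n \<theta>
    unfolding w_def by (simp add: norm_exp_eq_Re)
  define cell where "cell n = (\<lambda>\<theta>\<in>F. (r (Re (w n \<theta>)), r (Im (w n \<theta>))))" for n
  have "range cell \<subseteq> (\<Pi>\<^sub>E \<theta>\<in>F. {- int N..int N} \<times> {- int N..int N})"
    using abs_Re_le_cmod[of "w n \<theta>" for n \<theta>] abs_Im_le_cmod[of "w n \<theta>" for n \<theta>]
    by (auto simp: cell_def norm_w simp del: atLeastAtMost_iff intro!: r_range)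
  moreover have "finite (\<Pi>\<^sub>E \<theta>\<in>F. {- int N..int N} \<times> {- int N..int N})"
    using F by (intro finite_PiE) auto
  ultimately have "finite (range cell)"
    by (rule finite_subset)
  then have "finite (inv_into UNIV cell ` range cell)"
    by simp
  moreover have "\<exists>s\<in>inv_into UNIV cell ` range cell. \<forall>\<theta>\<in>F. cmod (w n \<theta> - w s \<theta>) \<le> e" for n
  proof (intro bexI ballI)
    fix \<theta> assume "\<theta> \<in> F"
    let ?s = "inv_into UNIV cell (cell n)"
    have "cell ?s = cell n"
      by (simp add: f_inv_into_f)
    from fun_cong[OF this, of \<theta>] \<open>\<theta> \<in> F\<close>
    have "r (Re (w n \<theta>)) = r (Re (w ?s \<theta>))" "r (Im (w n \<theta>)) = r (Im (w ?s \<theta>))"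
      by (simp_all add: cell_def)
    from this[THEN r_eq] have "cmod (w n \<theta> - w ?s \<theta>) \<le> 2 / N"
      using cmod_le[of "w n \<theta> - w ?s \<theta>"] by simp
    also have "\<dots> \<le> e"
      using N e \<open>real N > 0\<close> by (simp add: field_simps)
    finally show "cmod (w n \<theta> - w ?s \<theta>) \<le> e" .
  qed simp
  ultimately show thesis by (rule that)
qed

text \<open>If \<open>n\<close> and \<open>s\<close> give nearly the same characters on
  \<open>F\<close>, then \<open>n - s\<close> is an almost period. As \<open>s\<close> ranges over a
  finite net, \<open>n - s\<close> stays at bounded distance from \<open>n\<close>, so almost
  periods are relatively dense (Bohr).\<close>

lemma trig_poly_almost_periods:
  assumes "p \<in> trig_polys" "e > 0"
  obtains L :: nat where "\<And>n. \<exists>s\<in>{n..n + int L}. \<forall>m. cmod (p (m + s) - p m) \<le> e"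
proof -
  define w where "w n \<theta> = exp (2 * complex_of_real pi * \<i> * of_int n * complex_of_real \<theta>)"
    for n :: int and \<theta> :: real
  have w_add: "w (m + n) \<theta> = w m \<theta> * w n \<theta>" for m n \<theta>
    unfolding w_def by (simp flip: exp_add) (simp add: algebra_simps)
  have norm_w: "cmod (w n \<theta>) = 1" for n \<theta>
    unfolding w_def by (simp add: norm_exp_eq_Re)
  obtain F c where F: "finite F" and p: "p = (\<lambda>n. \<Sum>\<theta>\<in>F. c \<theta> * w n \<theta>)"
    using assms(1) unfolding trig_polys_def w_def by blast
  \<comment> \<open>The summand 1 keeps \<open>C\<close> positive even if all coefficients
    vanish.\<close>
  define C where "C = (\<Sum>\<theta>\<in>F. cmod (c \<theta>)) + 1"
  have "C > 0"
    unfolding C_def by (simp add: add_nonneg_pos sum_nonneg)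
  then obtain S where S: "finite S" "\<And>n. \<exists>s\<in>S. \<forall>\<theta>\<in>F. cmod (w n \<theta> - w s \<theta>) \<le> e / C"
    using characters_finite_net[OF F, of "e / C"] \<open>e > 0\<close>
    unfolding w_def by auto
  define B where "B = (\<Sum>s\<in>S. nat \<bar>s\<bar>)"
  have B: "\<bar>s\<bar> \<le> int B" if "s \<in> S" for s
    using member_le_sum[of s S "\<lambda>s. nat \<bar>s\<bar>"] S(1) that unfolding B_def by linarith
  \<comment> \<open>The net is applied at \<open>n + B\<close>, so that \<open>n + B - s\<close>
    with \<open>\<bar>s\<bar> \<le> B\<close> falls into a window starting at
    \<open>n\<close>.\<close>
  have "\<exists>s\<in>{n..n + int (2 * B)}. \<forall>m. cmod (p (m + s) - p m) \<le> e" for n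
  proof -
    obtain s where s: "s \<in> S" "\<And>\<theta>. \<theta> \<in> F \<Longrightarrow> cmod (w (n + B) \<theta> - w s \<theta>) \<le> e / C"
      using S(2)[of "n + int B"] by blast
    have "cmod (p (m + (n + B - s)) - p m) \<le> e" for m
    proof -
      \<comment> \<open>The unimodular factor \<open>w (m - s) \<theta>\<close> is common to both
        terms, which makes the estimate uniform in \<open>m\<close>.\<close>
      have "p (m + (n + B - s)) - p m
          = (\<Sum>\<theta>\<in>F. c \<theta> * (w (m - s) \<theta> * (w (n + B) \<theta> - w s \<theta>)))"
        unfolding p sum_subtractf[symmetric]
        by (intro sum.cong refl) (simp add: algebra_simps flip: w_add)
      also have "cmod \<dots> \<le> (\<Sum>\<theta>\<in>F. cmod (c \<theta>) * (e / C))"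
        using s(2) by (intro sum_norm_le) (auto simp: norm_mult norm_w simp del: times_divide_eq_right intro!: mult_left_mono)
      also have "\<dots> = (C - 1) * (e / C)"
        unfolding C_def by (simp add: sum_distrib_right sum_divide_distrib)
      also have "\<dots> \<le> e"
        using \<open>C > 0\<close> \<open>e > 0\<close> by (simp add: field_simps)
      finally show ?thesis .
    qed
    moreover have "n + B - s \<in> {n..n + int (2 * B)}"
      using B[OF s(1)] by auto
    ultimately show ?thesis by blast
  qed
  then show thesis by (rule that)
qed

text \<open>Relative density survives uniform limits: an \<open>e / 3\<close> almost period of a
  close trigonometric polynomial is an \<open>e\<close> almost period of \<open>x\<close>.\<close>

lemma AP_almost_periods:
  assumes "x \<in> AP" "e > 0"
  obtains L :: nat where "\<And>n. \<exists>s\<in>{n..n + int L}. \<forall>m. cmod (x (m + s) - x m) \<le> e"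
proof -
  obtain p where p: "p \<in> trig_polys" "\<And>n. cmod (x n - p n) \<le> e / 3"
    using assms AP_iff[of x] by (meson divide_pos_pos zero_less_numeral)
  obtain L :: nat where L: "\<And>n. \<exists>s\<in>{n..n + int L}. \<forall>m. cmod (p (m + s) - p m) \<le> e / 3"
    using trig_poly_almost_periods[OF p(1), of "e / 3"] \<open>e > 0\<close> by auto
  have "cmod (x (m + s) - x m) \<le> e" if "cmod (p (m + s) - p m) \<le> e / 3" for m s
  proof -
    have "x (m + s) - x m = (x (m + s) - p (m + s)) + (p (m + s) - p m) - (x m - p m)"
      by simp
    also have "cmod \<dots> \<le> cmod (x (m + s) - p (m + s)) + cmod (p (m + s) - p m) + cmod (x m - p m)"
      by (meson add_mono_thms_linordered_semiring(3) norm_triangle_ineq norm_triangle_ineq4 order_trans)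
    finally show ?thesis
      using p(2)[of "m + s"] p(2)[of m] that by linarith
  qed
  then show thesis
    using L by (intro that[of L]) blast
qed

lemma AP_bounded:
  assumes "x \<in> AP"
  obtains B where "\<And>n. cmod (x n) \<le> B"
proof -
  obtain g where "x = apply_bcontfun g"
    using assms unfolding AP_def by blast
  then show thesis
    using that norm_bounded by blast
qed

text \<open>A limsup in \<open>ereal\<close> is defined for arbitrary data and measurable in
  \<open>y\<close>. The windows have the dyadic lengths for which the strong law below is
  proved.\<close>

definition mean_square_increment :: "(int \<Rightarrow> complex) \<Rightarrow> nat \<Rightarrow> ereal" where
  "mean_square_increment y t =
     limsup (\<lambda>k. ereal ((\<Sum>m<2^k. (cmod (y (int m + int t) - y (int m)))\<^sup>2) / 2^k))"

lemma mean_square_increment_le: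
  assumes "\<And>m. cmod (y (m + int t) - y m) \<le> e"
  shows "mean_square_increment y t \<le> ereal (e\<^sup>2)"
  unfolding mean_square_increment_def
proof (intro Limsup_bounded always_eventually allI)
  fix k :: nat
  have "(\<Sum>m<2^k. (cmod (y (int m + int t) - y (int m)))\<^sup>2) \<le> (\<Sum>m<(2::nat)^k. e\<^sup>2)"
    by (intro sum_mono power_mono assms) auto
  then show "ereal ((\<Sum>m<2^k. (cmod (y (int m + int t) - y (int m)))\<^sup>2) / 2^k) \<le> ereal (e\<^sup>2)"
    by (simp add: field_simps)
qed

text \<open>Each of the \<open>N div W\<close> complete blocks contributes at least
  \<open>a\<close>. The factor 2 pays for the incomplete last block, because
  \<open>N \<ge> W\<close> ensures one complete block.\<close>

lemma sum_ge_of_block_hits: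
  fixes f :: "nat \<Rightarrow> real"
  assumes f: "\<And>m. f m \<ge> 0" and W: "W > 0" and N: "N \<ge> W"
    and hit: "\<And>n. \<exists>m\<in>{n..<n + W}. f m \<ge> a" and a: "a \<ge> 0"
  shows "a * N / (2 * W) \<le> (\<Sum>m<N. f m)"
proof -
  define q where "q = N div W"
  have "q * W \<le> N" unfolding q_def by simp
  have "q \<ge> 1" using W N by (simp add: q_def Suc_leI div_greater_zero_iff)
  have "N < (q + 1) * W"
    unfolding q_def using W by (simp add: dividend_less_times_div mult.commute)
  also have "\<dots> \<le> (2 * q) * W"
    using \<open>q \<ge> 1\<close> by (intro mult_right_mono) auto
  finally have "real N \<le> real (2 * q * W)" by linarith
  then have "a * N / (2 * W) \<le> a * real (2 * q * W) / (2 * W)"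
    using a W by (intro divide_right_mono mult_left_mono) auto
  also have "\<dots> = (\<Sum>i<q. a)"
    using W by simp
  also have "\<dots> \<le> (\<Sum>i<q. sum f {i * W..<i * W + W})"
  proof (intro sum_mono)
    fix i
    obtain m where "m \<in> {i * W..<i * W + W}" "f m \<ge> a"
      using hit by blast
    then show "a \<le> sum f {i * W..<i * W + W}"
      using member_le_sum[of m "{i * W..<i * W + W}" f] f by fastforce
  qed
  also have "\<dots> = sum f {..<q * W}"
    by (rule sum.nat_group)
  also have "\<dots> \<le> sum f {..<N}"
    using f \<open>q * W \<le> N\<close> by (intro sum_mono2) auto
  finally show ?thesis .
qed

text \<open>If \<open>t\<close> moves one value of \<open>x\<close> by more than \<open>3 * e\<close>, it moves by more than
  \<open>e\<close> the values at all translates of that position by \<open>e\<close>-almost periods, and these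
  have positive lower density.\<close>

lemma AP_increment_le_of_mean_square:
  assumes x: "x \<in> AP" and e: "e > 0"
  obtains d where "d > 0"
    "\<And>t n. mean_square_increment x t < ereal d \<Longrightarrow> cmod (x (n + int t) - x n) \<le> 3 * e"
proof -
  obtain L :: nat where L: "\<And>n. \<exists>s\<in>{n..n + int L}. \<forall>m. cmod (x (m + s) - x m) \<le> e"
    using AP_almost_periods[OF x e] by blast
  define W where "W = Suc L"
  \<comment> \<open>This is the density bound of \<open>sum_ge_of_block_hits\<close> for terms of
    size \<open>e\<^sup>2\<close>.\<close>
  define d where "d = e\<^sup>2 / (2 * W)"
  have "cmod (x (n + int t) - x n) \<le> 3 * e" if lt: "mean_square_increment x t < ereal d" for t n
  proof (rule ccontr)
    assume far: "\<not> cmod (x (n + int t) - x n) \<le> 3 * e"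
    let ?f = "\<lambda>m::nat. (cmod (x (int m + int t) - x (int m)))\<^sup>2"
    have hit: "\<exists>m\<in>{l..<l + W}. ?f m \<ge> e\<^sup>2" for l
    proof -
      \<comment> \<open>The window is shifted by \<open>- n\<close> so that the translate
        \<open>n + s\<close> of the bad position lands in the block starting at
        \<open>l\<close>.\<close>
      obtain s where s: "s \<in> {int l - n..int l - n + int L}"
        and per: "\<And>m. cmod (x (m + s) - x m) \<le> e"
        using L by blast
      define m where "m = nat (n + s)"
      have m: "int m = n + s" "m \<in> {l..<l + W}"
        using s unfolding m_def W_def by auto
      have "x (n + int t) - x n = (x (int m + int t) - x (int m))
          - (x ((n + int t) + s) - x (n + int t)) + (x (n + s) - x n)"
        by (simp add: m algebra_simps)
      also have "cmod \<dots> \<le> cmod (x (int m + int t) - x (int m))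
          + cmod (x ((n + int t) + s) - x (n + int t)) + cmod (x (n + s) - x n)"
        by (meson add_mono_thms_linordered_semiring(3) norm_triangle_ineq norm_triangle_ineq4 order_trans)
      finally have "e \<le> cmod (x (int m + int t) - x (int m))"
        using far per[of "n + int t"] per[of n] by linarith
      then have "?f m \<ge> e\<^sup>2"
        using e by (intro power_mono) auto
      with m(2) show ?thesis by blast
    qed
    have "\<forall>\<^sub>F k in sequentially. ereal d \<le> ereal (sum ?f {..<2^k} / 2^k)"
    proof (rule eventually_sequentiallyI[of W])
      fix k assume "W \<le> k"
      then have "W \<le> 2 ^ k"
        using less_exp[of k] by linarith
      from sum_ge_of_block_hits[of ?f W "2 ^ k" "e\<^sup>2", OF _ _ this hit]
      have "e\<^sup>2 * 2 ^ k / (2 * W) \<le> sum ?f {..<2^k}"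
        unfolding W_def by simp
      then show "ereal d \<le> ereal (sum ?f {..<2^k} / 2^k)"
        unfolding d_def by (simp add: field_simps)
    qed
    then have "ereal d \<le> liminf (\<lambda>k. ereal (sum ?f {..<2^k} / 2^k))"
      by (rule Liminf_bounded)
    also have "\<dots> \<le> mean_square_increment x t"
      unfolding mean_square_increment_def by (rule Liminf_le_Limsup) simp
    finally show False using lt by simp
  qed
  moreover have "d > 0"
    using e unfolding d_def W_def by simp
  ultimately show thesis by (intro that)
qed

text \<open>The parameter \<open>c\<close> is the contribution of the noise to the mean square: \<open>4\<close> for a noisy
  sequence, \<open>0\<close> for a noiseless one.\<close>

definition near_periods :: "real \<Rightarrow> nat \<Rightarrow> (int \<Rightarrow> complex) \<Rightarrow> nat set" where
  "near_periods c j y = {t. t > 0 \<and> mean_square_increment y t < ereal (c + 1 / Suc j)}"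

text \<open>Almost periods exist beyond every bound, and each has a small mean square. Infinitude
  makes \<open>enumerate\<close> strictly increasing, so that the averages below run over distinct
  shifts.\<close>

lemma AP_infinite_near_periods:
  assumes "x \<in> AP"
  shows "infinite (near_periods 0 j x)"
  unfolding infinite_nat_iff_unbounded_le
proof
  fix l :: nat
  \<comment> \<open>Its square is half the threshold, which makes the inequality strict.\<close>
  define e :: real where "e = sqrt (1 / (2 * Suc j))"
  have "e > 0" unfolding e_def by simp
  then obtain L :: nat where "\<And>n. \<exists>s\<in>{n..n + int L}. \<forall>m. cmod (x (m + s) - x m) \<le> e"
    using AP_almost_periods[OF assms] by blast
  then obtain s where s: "s \<ge> int (Suc l)" "\<And>m. cmod (x (m + s) - x m) \<le> e"
    by (meson atLeastAtMost_iff)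
  have "mean_square_increment x (nat s) \<le> ereal (e\<^sup>2)"
    using s by (intro mean_square_increment_le) simp
  also have "\<dots> < ereal (0 + 1 / Suc j)"
    unfolding e_def by (simp add: field_simps)
  finally show "\<exists>n\<ge>l. n \<in> near_periods 0 j x"
    using s(1) unfolding near_periods_def by (intro exI[of _ "nat s"]) auto
qed

text \<open>The thresholds \<open>1 / Suc j\<close> eventually fall below the \<open>d\<close> that
  forces increments of at most \<open>e\<close>, uniformly in \<open>n\<close>.\<close>

lemma AP_increment_near_periods:
  assumes x: "x \<in> AP" and e: "e > 0"
  shows "\<forall>\<^sub>F j in sequentially. \<forall>t\<in>near_periods 0 j x. \<forall>n. cmod (x (n + int t) - x n) \<le> e"
proof -
  obtain d where d: "d > 0"
    "\<And>t n. mean_square_increment x t < ereal d \<Longrightarrow> cmod (x (n + int t) - x n) \<le> 3 * (e / 3)"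
    using AP_increment_le_of_mean_square[OF x, of "e / 3"] e by auto
  obtain J where J: "1 / Suc J < d"
    using d(1) nat_approx_posE by blast
  show ?thesis
  proof (rule eventually_sequentiallyI[of J], intro ballI allI)
    fix j t n assume "J \<le> j" "t \<in> near_periods 0 j x"
    then have "mean_square_increment x t < ereal (1 / Suc j)"
      unfolding near_periods_def by simp
    also have "1 / Suc j \<le> 1 / Suc J"
      using \<open>J \<le> j\<close> by (simp add: frac_le)
    then have "ereal (1 / Suc j) < ereal d"
      using J by simp
    finally show "cmod (x (n + int t) - x n) \<le> e"
      using d(2) by fastforce
  qed
qed

text \<open>Since \<open>enumerate\<close> is total, this is meaningful even if the set of near
  periods is finite or empty, as can happen for arbitrary data.\<close>

definition near_period_average :: "real \<Rightarrow> nat \<Rightarrow> (int \<Rightarrow> complex) \<Rightarrow> int \<Rightarrow> complex" where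
  "near_period_average c j y n =
     (\<Sum>i<2^j. y (n + int (enumerate (near_periods c j y) i))) / 2^j"

lemma AP_near_period_average_tendsto:
  assumes x: "x \<in> AP"
  shows "(\<lambda>j. near_period_average 0 j x n) \<longlonglongrightarrow> x n"
  unfolding tendsto_iff
proof (intro allI impI)
  fix e :: real assume "e > 0"
  then have "\<forall>\<^sub>F j in sequentially.
      \<forall>t\<in>near_periods 0 j x. \<forall>n. cmod (x (n + int t) - x n) \<le> e / 2"
    by (intro AP_increment_near_periods[OF x]) simp
  then show "\<forall>\<^sub>F j in sequentially. dist (near_period_average 0 j x n) (x n) < e"
  proof eventually_elim
    case (elim j)
    let ?t = "enumerate (near_periods 0 j x)"
    have "near_period_average 0 j x n - x n = (\<Sum>i<2^j. x (n + int (?t i)) - x n) / 2^j"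
      unfolding near_period_average_def by (simp add: sum_subtractf field_simps)
    also have "cmod \<dots> = cmod (\<Sum>i<2^j. x (n + int (?t i)) - x n) / 2^j"
      by (simp add: norm_divide norm_power)
    also have "\<dots> \<le> (\<Sum>i<(2::nat)^j. e / 2) / 2^j"
      using elim enumerate_in_set[OF AP_infinite_near_periods[OF x]]
      by (intro divide_right_mono sum_norm_le) auto
    also have "\<dots> < e"
      using \<open>e > 0\<close> by simp
    finally show ?case by (simp add: dist_norm)
  qed
qed

text \<open>The recursion removes the least element, which turns a measurable family of sets into
  another one; hence the induction is over all \<open>S\<close>.\<close>

lemma measurable_enumerate [measurable (raw)]:
  fixes S :: "'a \<Rightarrow> nat set"
  assumes "\<And>t. Measurable.pred N (\<lambda>y. t \<in> S y)"
  shows "(\<lambda>y. enumerate (S y) i) \<in> N \<rightarrow>\<^sub>M count_space UNIV"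
  using assms
proof (induction i arbitrary: S)
  case 0
  note [measurable] = 0
  show ?case unfolding enumerate_0 by measurable
next
  case (Suc i)
  note [measurable] = Suc.prems
  have "Measurable.pred N (\<lambda>y. t \<in> S y - {LEAST n. n \<in> S y})" for t
    by simp
  from Suc.IH[OF this] show ?case
    unfolding enumerate_Suc .
qed

lemma borel_measurable_near_period_average:
  "(\<lambda>y. near_period_average c j y n) \<in> borel_measurable borel"
proof -
  have coord [measurable]: "(\<lambda>y::int \<Rightarrow> complex. y m) \<in> borel_measurable borel" for m
    by simp
  have [measurable]: "(\<lambda>y. mean_square_increment y t) \<in> borel_measurable borel" for t
    unfolding mean_square_increment_def by measurable
  have [measurable]: "Measurable.pred borel (\<lambda>y. t \<in> near_periods c j y)" for t
    unfolding near_periods_def by simp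
  \<comment> \<open>The index depends on \<open>y\<close> too, but takes countably many
    values.\<close>
  have [measurable]: "(\<lambda>y. y (n + int (enumerate (near_periods c j y) i))) \<in> borel_measurable borel" for i
    by (rule measurable_compose_countable[where f="\<lambda>k y. y (n + int k)"]) measurable
  show ?thesis
    unfolding near_period_average_def by measurable
qed

section \<open>Averages of weakly correlated variables\<close>

text \<open>By monotone convergence the sum of all \<open>f k\<close> has finite integral, so the
  series converges almost everywhere and its terms vanish in the limit.\<close>

lemma AE_tendsto_zero_of_summable_integral:
  fixes f :: "nat \<Rightarrow> 'a \<Rightarrow> real"
  assumes int: "\<And>k. integrable M (f k)" and nonneg: "\<And>k x. f k x \<ge> 0"
    and sum: "summable (\<lambda>k. integral\<^sup>L M (f k))"
  shows "AE x in M. (\<lambda>k. f k x) \<longlonglongrightarrow> 0"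
proof -
  have [measurable]: "f k \<in> borel_measurable M" for k
    using int by auto
  have "(\<integral>\<^sup>+x. (\<Sum>k. ennreal (f k x)) \<partial>M) = (\<Sum>k. \<integral>\<^sup>+x. ennreal (f k x) \<partial>M)"
    by (rule nn_integral_suminf) measurable
  also have "\<dots> = (\<Sum>k. ennreal (integral\<^sup>L M (f k)))"
    by (simp add: nn_integral_eq_integral int nonneg)
  also have "\<dots> \<noteq> \<infinity>"
    using sum by (simp add: suminf_ennreal2 integral_nonneg_AE nonneg)
  finally have "AE x in M. (\<Sum>k. ennreal (f k x)) \<noteq> \<infinity>"
    by (intro nn_integral_PInf_AE) measurable
  then show ?thesis
  proof eventually_elim
    case (elim x)
    then have "summable (\<lambda>k. f k x)"
      by (intro summable_suminf_not_top nonneg) simp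
    then show ?case by (rule summable_LIMSEQ_zero)
  qed
qed

lemma integrable_mult_of_squares:
  fixes f g :: "'a \<Rightarrow> real"
  assumes [measurable]: "f \<in> borel_measurable M" "g \<in> borel_measurable M"
    and "integrable M (\<lambda>x. (f x)\<^sup>2)" "integrable M (\<lambda>x. (g x)\<^sup>2)"
  shows "integrable M (\<lambda>x. f x * g x)"
proof (rule Bochner_Integration.integrable_bound)
  show "integrable M (\<lambda>x. (f x)\<^sup>2 + (g x)\<^sup>2)"
    using assms by simp
  have "\<bar>f x * g x\<bar> \<le> (f x)\<^sup>2 + (g x)\<^sup>2" for x
    using sum_squares_bound[of "\<bar>f x\<bar>" "\<bar>g x\<bar>"] mult_nonneg_nonneg[of "\<bar>f x\<bar>" "\<bar>g x\<bar>"]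
    by (simp add: abs_mult del: mult_nonneg_nonneg)
  then show "AE x in M. norm (f x * g x) \<le> norm ((f x)\<^sup>2 + (g x)\<^sup>2)"
    by auto
qed measurable

text \<open>Along the sample sizes \<open>2 ^ k\<close> Chebyshev's bounds are summable, so that bounded variances
  suffice and no monotonicity or truncation argument is needed.\<close>

lemma AE_dyadic_averages_tendsto_zero:
  fixes X :: "nat \<Rightarrow> nat \<Rightarrow> 'a \<Rightarrow> real"
  assumes [measurable]: "\<And>k i. X k i \<in> borel_measurable M"
    and sq: "\<And>k i. integrable M (\<lambda>\<omega>. (X k i \<omega>)\<^sup>2)"
    and bound: "\<And>k i. (\<integral>\<omega>. (X k i \<omega>)\<^sup>2 \<partial>M) \<le> C"
    and corr: "\<And>k i. card {j\<in>{..<2^k}. (\<integral>\<omega>. X k i \<omega> * X k j \<omega> \<partial>M) \<noteq> 0} \<le> d"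
  shows "AE \<omega> in M. (\<lambda>k. (\<Sum>i<2^k. X k i \<omega>) / 2^k) \<longlonglongrightarrow> 0"
proof -
  have "0 \<le> (\<integral>\<omega>. (X 0 0 \<omega>)\<^sup>2 \<partial>M)"
    by simp
  then have "C \<ge> 0"
    using bound[of 0 0] by linarith
  note prod = integrable_mult_of_squares[OF _ _ sq sq]
  have prod_le: "(\<integral>\<omega>. X k i \<omega> * X k j \<omega> \<partial>M) \<le> C" for k i j
  proof -
    have "(\<integral>\<omega>. X k i \<omega> * X k j \<omega> \<partial>M) \<le> (\<integral>\<omega>. ((X k i \<omega>)\<^sup>2 + (X k j \<omega>)\<^sup>2) / 2 \<partial>M)"
    proof (intro integral_mono prod)
      show "X k i \<omega> * X k j \<omega> \<le> ((X k i \<omega>)\<^sup>2 + (X k j \<omega>)\<^sup>2) / 2" for \<omega>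
        using sum_squares_bound[of "X k i \<omega>" "X k j \<omega>"] by simp
    qed (auto simp: sq)
    also have "\<dots> = ((\<integral>\<omega>. (X k i \<omega>)\<^sup>2 \<partial>M) + (\<integral>\<omega>. (X k j \<omega>)\<^sup>2 \<partial>M)) / 2"
      by (simp add: sq)
    also have "\<dots> \<le> C"
      using bound[of k i] bound[of k j] by simp
    finally show ?thesis .
  qed
  define A where "A k \<omega> = ((\<Sum>i<2^k. X k i \<omega>) / 2^k)\<^sup>2" for k \<omega>
  have A_eq: "A k = (\<lambda>\<omega>. (\<Sum>i<2^k. \<Sum>j<2^k. X k i \<omega> * X k j \<omega>) / (2^k)\<^sup>2)" for k
    unfolding A_def by (simp add: power_divide power2_eq_square sum_product)
  have int_A: "integrable M (A k)" for k
    unfolding A_eq by (intro integrable_divide Bochner_Integration.integrable_sum prod) auto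
  have le_A: "integral\<^sup>L M (A k) \<le> C * d * (1/2)^k" for k
  proof -
    \<comment> \<open>A row of the matrix of mixed moments has at most \<open>d\<close> nonzero
      entries. Summing \<open>2^k\<close> rows and dividing by \<open>(2^k)\<^sup>2\<close> leaves
      geometric decay.\<close>
    have row: "(\<Sum>j<2^k. \<integral>\<omega>. X k i \<omega> * X k j \<omega> \<partial>M) \<le> C * d" for i
    proof -
      let ?J = "{j\<in>{..<2^k}. (\<integral>\<omega>. X k i \<omega> * X k j \<omega> \<partial>M) \<noteq> 0}"
      have "(\<Sum>j<2^k. \<integral>\<omega>. X k i \<omega> * X k j \<omega> \<partial>M) = (\<Sum>j\<in>?J. \<integral>\<omega>. X k i \<omega> * X k j \<omega> \<partial>M)"
        by (intro sum.mono_neutral_right) auto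
      also have "\<dots> \<le> (\<Sum>j\<in>?J. C)"
        by (intro sum_mono prod_le)
      also have "\<dots> \<le> C * d"
        using corr[of k i] \<open>C \<ge> 0\<close> by (simp add: mult.commute mult_left_mono)
      finally show ?thesis .
    qed
    have "integral\<^sup>L M (A k) = (\<Sum>i<2^k. \<Sum>j<2^k. \<integral>\<omega>. X k i \<omega> * X k j \<omega> \<partial>M) / (2^k)\<^sup>2"
      unfolding A_eq
      by (simp add: Bochner_Integration.integral_sum Bochner_Integration.integrable_sum prod)
    also have "\<dots> \<le> (\<Sum>i<(2::nat)^k. C * d) / (2^k)\<^sup>2"
      by (intro divide_right_mono sum_mono row) simp
    also have "\<dots> = C * d * (1/2)^k"
      by (simp add: power2_eq_square field_simps)
    finally show ?thesis .
  qed
  have "summable (\<lambda>k. integral\<^sup>L M (A k))"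
  proof (rule summable_comparison_test')
    show "summable (\<lambda>k. C * d * (1/2::real)^k)"
      by (intro summable_mult summable_geometric) simp
    show "norm (integral\<^sup>L M (A k)) \<le> C * d * (1/2)^k" for k
      using le_A[of k] by (simp add: A_def)
  qed
  then have "AE \<omega> in M. (\<lambda>k. A k \<omega>) \<longlonglongrightarrow> 0"
    by (intro AE_tendsto_zero_of_summable_integral int_A) (simp_all add: A_def[abs_def])
  then show ?thesis
    unfolding A_def by eventually_elim (simp add: tendsto_null_power)
qed

text \<open>Restrictions of an independent family to disjoint index sets are independent, and so are
  functions of them. The case \<open>a = b\<close> covers single coordinates.\<close>

lemma (in prob_space) indep_var_disjoint_pairs:
  fixes f g :: "'b::{second_countable_topology} \<times> 'b \<Rightarrow> real"
  assumes ind: "indep_vars (\<lambda>_. borel) X UNIV" and disj: "{a, b} \<inter> {c, d} = {}"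
    and f: "f \<in> borel_measurable borel" and g: "g \<in> borel_measurable borel"
  shows "indep_var borel (\<lambda>\<omega>. f (X a \<omega>, X b \<omega>)) borel (\<lambda>\<omega>. g (X c \<omega>, X d \<omega>))"
proof -
  have pair: "(\<lambda>\<omega>. h (\<omega> i, \<omega> j)) \<in> borel_measurable (PiM {i, j} (\<lambda>_. borel))"
    if "h \<in> borel_measurable borel" for h :: "'b \<times> 'b \<Rightarrow> real" and i j
  proof (rule measurable_compose[of _ _ "borel \<Otimes>\<^sub>M borel"])
    show "(\<lambda>\<omega>. (\<omega> i, \<omega> j)) \<in> PiM {i, j} (\<lambda>_. borel) \<rightarrow>\<^sub>M borel \<Otimes>\<^sub>M (borel :: 'b measure)"
      by (intro measurable_Pair measurable_component_singleton) auto
    show "h \<in> borel_measurable (borel \<Otimes>\<^sub>M borel)"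
      using that by (simp add: borel_prod)
  qed
  from indep_var_compose[OF indep_var_restrict[OF ind disj] pair[OF f] pair[OF g]]
  show ?thesis by (simp add: comp_def)
qed

lemma gaussian_noise_indep_pairs:
  fixes f g :: "complex \<times> complex \<Rightarrow> real"
  assumes noise: "gaussian_noise M \<xi>" and disj: "{a, b} \<inter> {c, d} = {}"
    and "continuous_on UNIV f" "continuous_on UNIV g"
  shows "prob_space.indep_var M borel (\<lambda>\<omega>. f (\<xi> a \<omega>, \<xi> b \<omega>)) borel (\<lambda>\<omega>. g (\<xi> c \<omega>, \<xi> d \<omega>))"
  using assms
  by (intro prob_space.indep_var_disjoint_pairs borel_measurable_continuous_onI)
     (auto simp: gaussian_noise_def)

lemma std_normal_moments:
  assumes X: "distributed M lborel X std_normal_density"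
  shows "integrable M (\<lambda>\<omega>. X \<omega> ^ k)"
    and "(\<integral>\<omega>. X \<omega> \<partial>M) = 0"
    and "(\<integral>\<omega>. X \<omega> ^ (2 * k) \<partial>M) = fact (2 * k) / (2 ^ k * fact k)"
proof -
  show "integrable M (\<lambda>\<omega>. X \<omega> ^ k)"
    using distributed_integrable[OF X, of "\<lambda>x. x ^ k"] integrable_std_normal_moment by simp
  show "(\<integral>\<omega>. X \<omega> \<partial>M) = 0"
    using distributed_integral[OF X, of "\<lambda>x. x"] integral_std_normal_moment_odd[of 0] by simp
  show "(\<integral>\<omega>. X \<omega> ^ (2 * k) \<partial>M) = fact (2 * k) / (2 ^ k * fact k)"
    using distributed_integral[OF X, of "\<lambda>x. x ^ (2 * k)"] integral_std_normal_moment_even[of k]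
    by simp
qed

section \<open>Gaussian noise\<close>

text \<open>Once the square is expanded, the linear terms vanish by centring and the product term by
  independence; the 2 is the sum of two unit variances.\<close>

lemma std_normal_increment_second_moment:
  assumes "prob_space M"
    and X: "distributed M lborel X std_normal_density" and Y: "distributed M lborel Y std_normal_density"
    and ind: "prob_space.indep_var M borel X borel Y"
  shows "integrable M (\<lambda>\<omega>. (c + Y \<omega> - X \<omega>)\<^sup>2)"
    and "(\<integral>\<omega>. (c + Y \<omega> - X \<omega>)\<^sup>2 \<partial>M) = c\<^sup>2 + 2"
proof -
  interpret prob_space M by fact
  note X1 = std_normal_moments(1)[OF X, of 1, simplified] and Y1 = std_normal_moments(1)[OF Y, of 1, simplified]
  note X2 = std_normal_moments(1)[OF X, of 2] and Y2 = std_normal_moments(1)[OF Y, of 2]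
  note XY = indep_var_integrable[OF ind X1 Y1]
  have eq: "(c + Y \<omega> - X \<omega>)\<^sup>2
      = c\<^sup>2 + (Y \<omega>)\<^sup>2 + (X \<omega>)\<^sup>2 + 2 * c * Y \<omega> - 2 * c * X \<omega> - 2 * (X \<omega> * Y \<omega>)" for \<omega>
    by (simp add: power2_eq_square algebra_simps)
  show "integrable M (\<lambda>\<omega>. (c + Y \<omega> - X \<omega>)\<^sup>2)"
    unfolding eq using X1 Y1 X2 Y2 XY by simp
  show "(\<integral>\<omega>. (c + Y \<omega> - X \<omega>)\<^sup>2 \<partial>M) = c\<^sup>2 + 2"
    unfolding eq
    using X1 Y1 X2 Y2 XY std_normal_moments(2)[OF X] std_normal_moments(2)[OF Y]
      std_normal_moments(3)[OF X, of 1] std_normal_moments(3)[OF Y, of 1]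
      indep_var_lebesgue_integral[OF ind X1 Y1]
    by (simp add: prob_space)
qed

lemma gaussian_noise_components:
  assumes "gaussian_noise M \<xi>"
  shows "distributed M lborel (\<lambda>\<omega>. Re (\<xi> n \<omega>)) std_normal_density"
    and "distributed M lborel (\<lambda>\<omega>. Im (\<xi> n \<omega>)) std_normal_density"
  using assms by (auto simp: gaussian_noise_def standard_complex_gaussian_def)

lemma gaussian_noise_measurable:
  assumes "gaussian_noise M \<xi>"
  shows "\<xi> n \<in> borel_measurable M"
  using assms prob_space.indep_vars_def2[of M "\<lambda>_. borel" \<xi> UNIV]
  by (auto simp: gaussian_noise_def)

text \<open>A standard normal variable has fourth moment 3, so
  \<open>cmod z ^ 4 \<le> 2 * (Re z ^ 4 + Im z ^ 4)\<close> gives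
  \<open>2 * (3 + 3)\<close>.\<close>

lemma gaussian_noise_fourth_moment:
  assumes noise: "gaussian_noise M \<xi>"
  shows "integrable M (\<lambda>\<omega>. cmod (\<xi> n \<omega>) ^ 4)" and "(\<integral>\<omega>. cmod (\<xi> n \<omega>) ^ 4 \<partial>M) \<le> 12"
proof -
  note [measurable] = gaussian_noise_measurable[OF noise]
  note std = gaussian_noise_components[OF noise, of n]
  have le: "cmod z ^ 4 \<le> 2 * (Re z ^ 4 + Im z ^ 4)" for z
  proof -
    have "cmod z ^ 4 = ((Re z)\<^sup>2 + (Im z)\<^sup>2)\<^sup>2"
      using cmod_power2[of z] by (metis numeral_Bit0 mult_2 power_add power2_eq_square)
    also have "\<dots> \<le> 2 * ((Re z)\<^sup>2)\<^sup>2 + 2 * ((Im z)\<^sup>2)\<^sup>2"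
      using sum_squares_bound[of "(Re z)\<^sup>2" "(Im z)\<^sup>2"] by (simp add: power2_sum)
    finally show ?thesis by simp
  qed
  have dom: "integrable M (\<lambda>\<omega>. 2 * (Re (\<xi> n \<omega>) ^ 4 + Im (\<xi> n \<omega>) ^ 4))"
    using std_normal_moments(1)[OF std(1)] std_normal_moments(1)[OF std(2)] by simp
  show int: "integrable M (\<lambda>\<omega>. cmod (\<xi> n \<omega>) ^ 4)"
    by (rule Bochner_Integration.integrable_bound[OF dom]) (use le in auto)
  have "(\<integral>\<omega>. cmod (\<xi> n \<omega>) ^ 4 \<partial>M) \<le> (\<integral>\<omega>. 2 * (Re (\<xi> n \<omega>) ^ 4 + Im (\<xi> n \<omega>) ^ 4) \<partial>M)"
    by (intro integral_mono int dom le)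
  also have "\<dots> = 12"
    using std_normal_moments(1,3)[OF std(1)] std_normal_moments(1,3)[OF std(2)]
      std_normal_moments(3)[OF std(1), of 2] std_normal_moments(3)[OF std(2), of 2]
    by (simp add: fact_numeral)
  finally show "(\<integral>\<omega>. cmod (\<xi> n \<omega>) ^ 4 \<partial>M) \<le> 12" .
qed

text \<open>The 4 is a contribution of 2 from each of the real and imaginary parts. It is the shift
  by which noise raises mean squares; the second moment bound feeds the strong law.\<close>

lemma gaussian_noise_increment:
  fixes u :: complex
  assumes noise: "gaussian_noise M \<xi>" and ab: "a \<noteq> b"
  defines "W \<equiv> \<lambda>\<omega>. (cmod (u + \<xi> b \<omega> - \<xi> a \<omega>))\<^sup>2"
  shows "integrable M W" and "(\<integral>\<omega>. W \<omega> \<partial>M) = (cmod u)\<^sup>2 + 4"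
    and "integrable M (\<lambda>\<omega>. (W \<omega>)\<^sup>2)" and "(\<integral>\<omega>. (W \<omega>)\<^sup>2 \<partial>M) \<le> 27 * (cmod u ^ 4 + 24)"
proof -
  interpret prob_space M using noise by (simp add: gaussian_noise_def)
  note [measurable] = gaussian_noise_measurable[OF noise]
  have ab': "{a, a} \<inter> {b, b} = {}" using ab by simp
  have ind: "indep_var borel (\<lambda>\<omega>. Re (\<xi> a \<omega>)) borel (\<lambda>\<omega>. Re (\<xi> b \<omega>))"
    "indep_var borel (\<lambda>\<omega>. Im (\<xi> a \<omega>)) borel (\<lambda>\<omega>. Im (\<xi> b \<omega>))"
    using gaussian_noise_indep_pairs[OF noise ab', of "\<lambda>p. Re (fst p)" "\<lambda>p. Re (fst p)"]
      gaussian_noise_indep_pairs[OF noise ab', of "\<lambda>p. Im (fst p)" "\<lambda>p. Im (fst p)"]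
    by (simp_all add: continuous_intros)
  note re = std_normal_increment_second_moment[OF prob_space_axioms
      gaussian_noise_components(1)[OF noise] gaussian_noise_components(1)[OF noise] ind(1), of "Re u"]
  note im = std_normal_increment_second_moment[OF prob_space_axioms
      gaussian_noise_components(2)[OF noise] gaussian_noise_components(2)[OF noise] ind(2), of "Im u"]
  have W_eq: "W = (\<lambda>\<omega>. (Re u + Re (\<xi> b \<omega>) - Re (\<xi> a \<omega>))\<^sup>2 + (Im u + Im (\<xi> b \<omega>) - Im (\<xi> a \<omega>))\<^sup>2)"
    unfolding W_def by (simp add: cmod_power2)
  show "integrable M W"
    unfolding W_eq using re(1) im(1) by simp
  show "(\<integral>\<omega>. W \<omega> \<partial>M) = (cmod u)\<^sup>2 + 4"
    unfolding W_eq using re im by (simp add: cmod_power2)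
  \<comment> \<open>The three-term bound \<open>sq3\<close> is used twice: its factor 3 is squared
    once and then met again, giving 27.\<close>
  have quartic: "((cmod (u + v - z))\<^sup>2)\<^sup>2 \<le> 27 * (cmod u ^ 4 + cmod v ^ 4 + cmod z ^ 4)" for v z
  proof -
    have sq3: "(p + q + r)\<^sup>2 \<le> 3 * (p\<^sup>2 + q\<^sup>2 + r\<^sup>2)" for p q r :: real
      using sum_squares_bound[of p q] sum_squares_bound[of q r] sum_squares_bound[of p r]
      by (simp add: power2_eq_square algebra_simps)
    have "cmod (u + v - z) \<le> cmod u + cmod v + cmod z"
      by (meson add_mono_thms_linordered_semiring(3) norm_triangle_ineq norm_triangle_ineq4 order_trans)
    then have "(cmod (u + v - z))\<^sup>2 \<le> (cmod u + cmod v + cmod z)\<^sup>2"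
      by (intro power_mono) auto
    also note sq3
    finally have "((cmod (u + v - z))\<^sup>2)\<^sup>2 \<le> (3 * ((cmod u)\<^sup>2 + (cmod v)\<^sup>2 + (cmod z)\<^sup>2))\<^sup>2"
      by (intro power_mono) auto
    also have "\<dots> \<le> 9 * (3 * (((cmod u)\<^sup>2)\<^sup>2 + ((cmod v)\<^sup>2)\<^sup>2 + ((cmod z)\<^sup>2)\<^sup>2))"
      unfolding power_mult_distrib
      using sq3[of "(cmod u)\<^sup>2" "(cmod v)\<^sup>2" "(cmod z)\<^sup>2"] by simp
    finally show ?thesis by simp
  qed
  note m4 = gaussian_noise_fourth_moment[OF noise]
  have dom: "integrable M (\<lambda>\<omega>. 27 * (cmod u ^ 4 + cmod (\<xi> b \<omega>) ^ 4 + cmod (\<xi> a \<omega>) ^ 4))"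
    using m4(1) by simp
  show int: "integrable M (\<lambda>\<omega>. (W \<omega>)\<^sup>2)"
    unfolding W_def
    by (rule Bochner_Integration.integrable_bound[OF dom]) (use quartic in auto)
  have "(\<integral>\<omega>. (W \<omega>)\<^sup>2 \<partial>M) \<le> (\<integral>\<omega>. 27 * (cmod u ^ 4 + cmod (\<xi> b \<omega>) ^ 4 + cmod (\<xi> a \<omega>) ^ 4) \<partial>M)"
    using int dom quartic unfolding W_def by (intro integral_mono)
  also have "\<dots> = 27 * (cmod u ^ 4 + (\<integral>\<omega>. cmod (\<xi> b \<omega>) ^ 4 \<partial>M) + (\<integral>\<omega>. cmod (\<xi> a \<omega>) ^ 4 \<partial>M))"
    using m4(1) by (simp add: prob_space)
  also have "\<dots> \<le> 27 * (cmod u ^ 4 + 24)"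
    using m4(2)[of a] m4(2)[of b] by simp
  finally show "(\<integral>\<omega>. (W \<omega>)\<^sup>2 \<partial>M) \<le> 27 * (cmod u ^ 4 + 24)" .
qed

text \<open>The strong law applies to real and imaginary parts separately, each variable being
  correlated only with itself. The indices are deterministic but may change with \<open>j\<close>,
  as near periods do.\<close>

lemma AE_noise_average_tendsto_zero:
  fixes \<tau> :: "nat \<Rightarrow> nat \<Rightarrow> int"
  assumes noise: "gaussian_noise M \<xi>" and inj: "\<And>j. inj (\<tau> j)"
  shows "AE \<omega> in M. (\<lambda>j. (\<Sum>i<2^j. \<xi> (\<tau> j i) \<omega>) / 2^j) \<longlonglongrightarrow> 0"
proof -
  interpret prob_space M using noise by (simp add: gaussian_noise_def)
  note [measurable] = gaussian_noise_measurable[OF noise]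
  have avg: "AE \<omega> in M. (\<lambda>j. (\<Sum>i<2^j. R (\<xi> (\<tau> j i) \<omega>)) / 2^j) \<longlonglongrightarrow> 0"
    if R: "\<And>n. distributed M lborel (\<lambda>\<omega>. R (\<xi> n \<omega>)) std_normal_density"
      and cont: "continuous_on UNIV R" for R :: "complex \<Rightarrow> real"
  proof (rule AE_dyadic_averages_tendsto_zero[where C=1 and d=1])
    note [measurable] = borel_measurable_continuous_onI[OF cont]
    show "(\<lambda>\<omega>. R (\<xi> (\<tau> j i) \<omega>)) \<in> borel_measurable M" for j i
      by measurable
    show "integrable M (\<lambda>\<omega>. (R (\<xi> (\<tau> j i) \<omega>))\<^sup>2)" for j i
      by (rule std_normal_moments[OF R])
    show "(\<integral>\<omega>. (R (\<xi> (\<tau> j i) \<omega>))\<^sup>2 \<partial>M) \<le> 1" for j i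
      using std_normal_moments(3)[OF R, where k=1] by simp
    have uncorrelated: "(\<integral>\<omega>. R (\<xi> (\<tau> k i) \<omega>) * R (\<xi> (\<tau> k j) \<omega>) \<partial>M) = 0"
      if "i \<noteq> j" for k i j
    proof -
      have disj: "{\<tau> k i, \<tau> k i} \<inter> {\<tau> k j, \<tau> k j} = {}"
        using injD[OF inj] that by blast
      have cont': "continuous_on UNIV (\<lambda>p :: complex \<times> complex. R (fst p))"
        by (rule continuous_on_compose2[OF cont]) (auto intro: continuous_intros)
      have "indep_var borel (\<lambda>\<omega>. R (\<xi> (\<tau> k i) \<omega>)) borel (\<lambda>\<omega>. R (\<xi> (\<tau> k j) \<omega>))"
        using gaussian_noise_indep_pairs[OF noise disj, of "\<lambda>p. R (fst p)" "\<lambda>p. R (fst p)"] cont'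
        by simp
      then show ?thesis
        using std_normal_moments(1)[OF R, where k=1] std_normal_moments(2)[OF R]
        by (simp add: indep_var_lebesgue_integral)
    qed
    have "{j\<in>{..<2^k}. (\<integral>\<omega>. R (\<xi> (\<tau> k i) \<omega>) * R (\<xi> (\<tau> k j) \<omega>) \<partial>M) \<noteq> 0} \<subseteq> {i}" for k i
      by (rule subsetI, rule ccontr) (auto simp: uncorrelated)
    from card_mono[OF _ this]
    show "card {j\<in>{..<2^k}. (\<integral>\<omega>. R (\<xi> (\<tau> k i) \<omega>) * R (\<xi> (\<tau> k j) \<omega>) \<partial>M) \<noteq> 0} \<le> 1" for k i
      by simp
  qed
  have "AE \<omega> in M. (\<lambda>j. (\<Sum>i<2^j. Re (\<xi> (\<tau> j i) \<omega>)) / 2^j) \<longlonglongrightarrow> 0"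
    "AE \<omega> in M. (\<lambda>j. (\<Sum>i<2^j. Im (\<xi> (\<tau> j i) \<omega>)) / 2^j) \<longlonglongrightarrow> 0"
    by (intro avg gaussian_noise_components[OF noise] continuous_intros)+
  then show ?thesis
  proof eventually_elim
    case (elim \<omega>)
    have "z / 2 ^ j = Complex (Re z / 2 ^ j) (Im z / 2 ^ j)" for z :: complex and j
      using Re_divide_of_real[of z "2 ^ j"] Im_divide_of_real[of z "2 ^ j"]
      by (simp add: complex_eq_iff)
    then show ?case
      using tendsto_Complex[OF elim] by (simp flip: zero_complex.code)
  qed
qed

text \<open>Centred squared increments at \<open>i\<close> and \<open>j\<close> are independent
  unless they share a noise site, which leaves at most three \<open>j\<close> for each
  \<open>i\<close>. Boundedness of \<open>x\<close> makes the variances uniformly bounded.\<close>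

lemma AE_increment_average:
  fixes x :: "int \<Rightarrow> complex"
  assumes noise: "gaussian_noise M \<xi>" and x: "\<And>n. cmod (x n) \<le> B" and t: "t > 0"
  defines "y \<equiv> \<lambda>\<omega> n. x n + \<xi> n \<omega>"
  shows "AE \<omega> in M. (\<lambda>k.
    (\<Sum>m<2^k. (cmod (y \<omega> (int m + int t) - y \<omega> (int m)))\<^sup>2
       - ((cmod (x (int m + int t) - x (int m)))\<^sup>2 + 4)) / 2^k) \<longlonglongrightarrow> 0"
proof -
  interpret prob_space M using noise by (simp add: gaussian_noise_def)
  note [measurable] = gaussian_noise_measurable[OF noise]
  define u where "u m = x (int m + int t) - x (int m)" for m
  define W where "W m \<omega> = (cmod (u m + \<xi> (int m + int t) \<omega> - \<xi> (int m) \<omega>))\<^sup>2" for m \<omega>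
  define Z where "Z m \<omega> = W m \<omega> - ((cmod (u m))\<^sup>2 + 4)" for m \<omega>
  \<comment> \<open>For \<open>t = 0\<close> the noise would cancel instead of contributing
    4.\<close>
  have ne: "int m \<noteq> int m + int t" for m using t by simp
  have u: "cmod (u m) \<le> 2 * B" for m
    unfolding u_def using norm_triangle_ineq4[of "x (int m + int t)" "x (int m)"] x[of "int m"] x[of "int m + int t"]
    by linarith
  have W_m [measurable]: "W m \<in> borel_measurable M" for m
    unfolding W_def by measurable
  have W1: "integrable M (W m)" "(\<integral>\<omega>. W m \<omega> \<partial>M) = (cmod (u m))\<^sup>2 + 4" for m
    unfolding W_def using gaussian_noise_increment[OF noise ne] by auto
  have W2: "integrable M (\<lambda>\<omega>. (W m \<omega>)\<^sup>2)" "(\<integral>\<omega>. (W m \<omega>)\<^sup>2 \<partial>M) \<le> 27 * (cmod (u m) ^ 4 + 24)" for m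
    unfolding W_def using gaussian_noise_increment[OF noise ne] by auto
  have Z1: "integrable M (Z m)" "(\<integral>\<omega>. Z m \<omega> \<partial>M) = 0" for m
    unfolding Z_def using W1 by (auto simp: prob_space)
  have Z2: "integrable M (\<lambda>\<omega>. (Z m \<omega>)\<^sup>2)" for m
    unfolding Z_def power2_diff using W1 W2 by simp
  \<comment> \<open>Subtraction is truncated here: for \<open>i < t\<close> the last entry is 0,
    which merely excludes one more index.\<close>
  have Z_ind: "(\<integral>\<omega>. Z i \<omega> * Z j \<omega> \<partial>M) = 0" if "j \<notin> {i, i + t, i - t}" for i j
  proof -
    define h where "h m p = (cmod (u m + snd p - fst p))\<^sup>2 - ((cmod (u m))\<^sup>2 + 4)" for m p
    have h: "continuous_on UNIV (h m)" for m
      unfolding h_def by (intro continuous_intros)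
    have "{int i, int i + int t} \<inter> {int j, int j + int t} = {}"
      using that by auto
    from gaussian_noise_indep_pairs[OF noise this h h]
    have "indep_var borel (Z i) borel (Z j)"
      unfolding Z_def W_def h_def by simp
    then show ?thesis
      using Z1 by (simp add: indep_var_lebesgue_integral)
  qed
  have "AE \<omega> in M. (\<lambda>k. (\<Sum>m<2^k. Z m \<omega>) / 2^k) \<longlonglongrightarrow> 0"
  proof (rule AE_dyadic_averages_tendsto_zero[where C="27 * ((2 * B) ^ 4 + 24)" and d=3])
    show "Z m \<in> borel_measurable M" for m
      unfolding Z_def by measurable
    show "integrable M (\<lambda>\<omega>. (Z m \<omega>)\<^sup>2)" for m by fact
    show "(\<integral>\<omega>. (Z m \<omega>)\<^sup>2 \<partial>M) \<le> 27 * ((2 * B) ^ 4 + 24)" for m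
    proof -
      have "(\<integral>\<omega>. (Z m \<omega>)\<^sup>2 \<partial>M) = variance (W m)"
        unfolding Z_def W1(2) ..
      also have "\<dots> \<le> (\<integral>\<omega>. (W m \<omega>)\<^sup>2 \<partial>M)"
        using W1(1) W2(1) by (simp add: variance_eq)
      also have "\<dots> \<le> 27 * (cmod (u m) ^ 4 + 24)"
        by (rule W2)
      also have "\<dots> \<le> 27 * ((2 * B) ^ 4 + 24)"
        using power_mono[OF u[of m], of 4] by simp
      finally show ?thesis .
    qed
    have "{j\<in>{..<2^k}. (\<integral>\<omega>. Z i \<omega> * Z j \<omega> \<partial>M) \<noteq> 0} \<subseteq> {i, i + t, i - t}" for i k
      using Z_ind by blast
    from card_mono[OF _ this]
    show "card {j\<in>{..<2^k}. (\<integral>\<omega>. Z i \<omega> * Z j \<omega> \<partial>M) \<noteq> 0} \<le> 3" for i k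
      using card_insert_le_m1[of 3 "{i + t, i - t}" i] card_insert_le_m1[of 2 "{i - t}" "i + t"]
      by (fastforce intro: order_trans)
  qed
  then show ?thesis
    unfolding Z_def W_def u_def y_def by (simp add: algebra_simps)
qed

section \<open>Recovery\<close>

text \<open>The window averages of noisy and clean data differ by a sequence converging to 4, and a
  finite limit can be taken out of a limsup.\<close>

lemma AE_mean_square_increment:
  assumes noise: "gaussian_noise M \<xi>" and x: "\<And>n. cmod (x n) \<le> B" and t: "t > 0"
  shows "AE \<omega> in M. mean_square_increment (\<lambda>n. x n + \<xi> n \<omega>) t = 4 + mean_square_increment x t"
  using AE_increment_average[where x=x, OF assms]
proof eventually_elim
  case (elim \<omega>)
  let ?y = "\<lambda>n. x n + \<xi> n \<omega>"
  define a b where "a k = (\<Sum>m<2^k. (cmod (?y (int m + int t) - ?y (int m)))\<^sup>2) / 2^k"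
    and "b k = (\<Sum>m<2^k. (cmod (x (int m + int t) - x (int m)))\<^sup>2) / 2^k" for k :: nat
  have "(\<lambda>k. a k - b k - 4) \<longlonglongrightarrow> 0"
    using elim unfolding a_def b_def
    by (simp add: sum_subtractf sum.distrib diff_divide_distrib add_divide_distrib algebra_simps)
  from tendsto_add[OF this tendsto_const[of 4]] have "(\<lambda>k. ereal (a k - b k)) \<longlonglongrightarrow> ereal 4"
    by simp
  then have "limsup (\<lambda>k. ereal (a k - b k) + ereal (b k)) = ereal 4 + limsup (\<lambda>k. ereal (b k))"
    by (rule ereal_limsup_lim_add) simp
  then show ?case
    unfolding mean_square_increment_def a_def b_def by simp
qed

text \<open>There are countably many \<open>t\<close>, so one null set suffices. Though computed
  from noisy data, the shifts are thus almost surely deterministic, and averaging over them involves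
  no selection bias.\<close>

lemma AE_near_periods:
  assumes noise: "gaussian_noise M \<xi>" and x: "\<And>n. cmod (x n) \<le> B"
  shows "AE \<omega> in M. \<forall>j. near_periods 4 j (\<lambda>n. x n + \<xi> n \<omega>) = near_periods 0 j x"
proof -
  have "AE \<omega> in M. \<forall>t>0.
      mean_square_increment (\<lambda>n. x n + \<xi> n \<omega>) t = 4 + mean_square_increment x t"
    using AE_mean_square_increment[where x=x, OF assms] by (simp add: AE_all_countable)
  then show ?thesis
  proof eventually_elim
    case (elim \<omega>)
    have "4 + d < ereal (4 + c) \<longleftrightarrow> d < ereal c" for d :: ereal and c
      by (cases d) auto
    with elim show ?case
      unfolding near_periods_def by auto
  qed
qed

text \<open>Measurability into the product is checked coordinatewise; \<open>lim\<close> is total,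
  so the map is also defined where the averages diverge.\<close>

lemma borel_measurable_lim_near_period_average:
  "(\<lambda>y n. lim (\<lambda>j. near_period_average c j y n)) \<in> borel_measurable borel"
  by (intro measurable_coordinatewise_then_product borel_measurable_lim_metric
      borel_measurable_near_period_average)

theorem theorem1p6:
  fixes M :: "'w measure" and \<xi> :: "int \<Rightarrow> 'w \<Rightarrow> complex"
  assumes "gaussian_noise M \<xi>"
  shows "admits_recovery M \<xi> AP"
  unfolding admits_recovery_def
proof (intro exI[of _ "\<lambda>y n. lim (\<lambda>j. near_period_average 4 j y n)"] conjI ballI)
  show "(\<lambda>y n. lim (\<lambda>j. near_period_average 4 j y n)) \<in> borel_measurable borel"
    by (rule borel_measurable_lim_near_period_average)
next
  fix x assume x: "x \<in> AP"
  then obtain B where B: "\<And>n. cmod (x n) \<le> B"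
    using AP_bounded by blast
  let ?t = "\<lambda>j. enumerate (near_periods 0 j x)"
  have "inj (\<lambda>i. n + int (?t j i))" for n j
    using strict_mono_imp_inj_on[OF strict_mono_enumerate[OF AP_infinite_near_periods[OF x]]]
    by (auto simp: inj_def)
  then have "AE \<omega> in M. \<forall>n. (\<lambda>j. (\<Sum>i<2^j. \<xi> (n + int (?t j i)) \<omega>) / 2^j) \<longlonglongrightarrow> 0"
    unfolding AE_all_countable by (intro allI AE_noise_average_tendsto_zero[OF assms])
  with AE_near_periods[where x=x, OF assms B]
  show "AE \<omega> in M. (\<lambda>n. lim (\<lambda>j. near_period_average 4 j (\<lambda>n. x n + \<xi> n \<omega>) n)) = x"
  proof eventually_elim
    case (elim \<omega>)
    have "(\<lambda>j. near_period_average 4 j (\<lambda>n. x n + \<xi> n \<omega>) n) \<longlonglongrightarrow> x n" for n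
    proof -
      \<comment> \<open>On the good event both sides use the near periods of \<open>x\<close>, so
        the average splits linearly into signal and noise.\<close>
      have "near_period_average 4 j (\<lambda>n. x n + \<xi> n \<omega>) n
          = near_period_average 0 j x n + (\<Sum>i<2^j. \<xi> (n + int (?t j i)) \<omega>) / 2^j" for j
        unfolding near_period_average_def elim(1)[rule_format]
        by (simp add: sum.distrib add_divide_distrib)
      then show ?thesis
        using tendsto_add[OF AP_near_period_average_tendsto[OF x] elim(2)[rule_format]] by simp
    qed
    then show ?case
      by (intro ext limI)
  qed
qed

end
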